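(* Suppose $(P,Q,R)$ satisfies the system associated to the generalised Chazy equation with parameter $k=2$: $$P'=\tfrac16(P^2-Q),\qquad Q'=\tfrac23(PQ-R),\qquad R'=PR+\tfrac18Q^2.$$ Then the triple $$\left(P+2\mu,\;\frac{5}{4}Q+10\mu^2,\;\frac{5}{4}R+\frac{25}{8}Q\mu+35\mu^3\right)$$ satisfies the system associated to the generalised Chazy equation with parameter $k=\frac23$ (i.e. $p'=\frac16(p^2-q)$, $q'=\frac23(pq-r)$, $r'=pr+\frac1{80}q^2$ for the triple $(p,q,r)$), where $\mu$ is a root of the quartic equation $$\mu^4+\frac{1}{12}Q\mu^2+\frac{1}{27}R\mu-\frac{1}{1728}Q^2=0.$$ Conversely, let $(P,Q,R)$ be a solution to the system associated to the $k=\frac23$ generalised Chazy equation. Then $$\left(P-\frac{Q^2}{40R},\;\frac{4}{5}Q-\frac{Q^4}{800R^2},\;\frac{4}{5}R-\frac{Q^3}{40R}-\frac{Q^6}{64000R^3}\right)$$ solves the system associated to the $k=2$ generalised Chazy equation.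
   Context: The first order system associated to the generalised Chazy equation with parameter $k$, for functions $P,Q,R$ of $x$ (with $'=d/dx$), is $$P'=\tfrac16(P^2-Q),\qquad Q'=\tfrac23(PQ-R),\qquad R'=PR+\frac{k^2}{36-k^2}Q^2;$$ a triple "satisfies the system with parameter $k$" if its first, second and third entries satisfy these equations in the roles of $P,Q,R$. Quantities introduced as roots of polynomial equations are differentiable functions of $x$ (branches) satisfying the defining relations identically in $x$, and all statements are understood where the displayed denominators are nonzero. *)

theory Defs
  imports "HOL-Analysis.Analysis"
begin

text \<open>
  The independent variable ranges over an open set \<open>S\<close> of an arbitrary real normed field, which
  covers both the real and the complex-analytic reading of the system.
\<close>

definition chazy_system ::
  "'a::real_normed_field \<Rightarrow> 'a set \<Rightarrow> ('a \<Rightarrow> 'a) \<Rightarrow> ('a \<Rightarrow> 'a) \<Rightarrow> ('a \<Rightarrow> 'a) \<Rightarrow> bool" where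
  "chazy_system k S P Q R \<longleftrightarrow> (\<forall>x\<in>S.
     (P has_field_derivative 1 / 6 * ((P x)\<^sup>2 - Q x)) (at x) \<and>
     (Q has_field_derivative 2 / 3 * (P x * Q x - R x)) (at x) \<and>
     (R has_field_derivative P x * R x + k\<^sup>2 / (36 - k\<^sup>2) * (Q x)\<^sup>2) (at x))"

end

theory Submission imports Defs begin

text \<open>
  Substituting the transformed triples into the target systems is a polynomial computation as
  soon as the derivative of \<open>\<mu>\<close> is known to be \<open>P \<mu> / 3 - \<mu>\<^sup>2 / 2 - Q / 48\<close>, which is exactly what
  the first equation of the target system requires. Where \<open>\<mu>\<close> is a simple root of
  the quartic this formula follows by differentiating the quartic.

  At a multiple root that argument says nothing about \<open>\<mu>'\<close>, and no hypothesis excludes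
  multiple roots. They are governed by the quantity \<open>D = Q\<^sup>3 + 8 R\<^sup>2\<close>: a multiple root forces it to
  vanish (\<open>multiple_root_values\<close>). Along a solution it satisfies the linear equation
  \<open>D' = 2 P D\<close>, so if it vanishes at a point it vanishes in a neighbourhood
  (\<open>locally_zero_if_derivative_bounded\<close>). There the quartic factors with a triple root,
  namely \<open>- R / (3 Q)\<close>, which can be differentiated directly when \<open>Q \<noteq> 0\<close>; if instead
  \<open>Q = R = 0\<close> at the point, then the same uniqueness principle makes
  \<open>Q\<close>, \<open>R\<close> and \<open>\<mu>\<close> vanish nearby.

  The converse transformation is rational in \<open>P\<close>, \<open>Q\<close>, \<open>R\<close>, so there it is enough to differentiate.
\<close>

section \<open>Uniqueness for linear differential equations\<close>

text \<open>
  This is the uniqueness part of the theory of linear differential equations. On a ball so small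
  that \<open>M\<close> times its radius is at most \<open>1/2\<close>, the mean value inequality improves any bound on \<open>f\<close>
  by a factor of two, hence \<open>f\<close> is bounded by every power of \<open>1/2\<close>.
\<close>

lemma locally_zero_if_derivative_bounded:
  fixes f f' :: "'a::real_normed_field \<Rightarrow> 'a"
  assumes ev: "eventually (\<lambda>x. (f has_field_derivative f' x) (at x) \<and>
                               norm (f' x) \<le> M * norm (f x)) (nhds x0)"
    and zero: "f x0 = 0"
  shows "eventually (\<lambda>x. f x = 0) (nhds x0)"
proof -
  from ev have "(f has_field_derivative f' x0) (at x0)"
    using eventually_nhds_x_imp_x by fastforce
  then have "isCont f x0"
    by (rule DERIV_isCont)
  then have "(f \<longlongrightarrow> 0) (nhds x0)"
    using zero by (simp add: continuous_at filterlim_at_within_not_equal tendsto_nhds_iff)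
  then have "eventually (\<lambda>x. norm (f x) < 1) (nhds x0)"
    using order_tendstoD(2)[OF tendsto_norm, of f 0 "nhds x0" 1] by simp
  with ev have "eventually (\<lambda>x. ((f has_field_derivative f' x) (at x) \<and>
      norm (f' x) \<le> M * norm (f x)) \<and> norm (f x) < 1) (nhds x0)"
    by (rule eventually_conj)
  then obtain d where d: "d > 0" and in_ball: "\<And>x. dist x x0 < d \<Longrightarrow>
      (f has_field_derivative f' x) (at x) \<and> norm (f' x) \<le> M * norm (f x) \<and> norm (f x) < 1"
    unfolding eventually_nhds_metric by blast
  define r where "r = min d (1 / (2 * (\<bar>M\<bar> + 1)))"
  have r: "r > 0" "r \<le> d" "\<bar>M\<bar> * r \<le> 1 / 2"
  proof -
    show "r > 0" "r \<le> d"
      using d by (auto simp: r_def)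
    have "\<bar>M\<bar> * r \<le> \<bar>M\<bar> * (1 / (2 * (\<bar>M\<bar> + 1)))"
      by (intro mult_left_mono) (auto simp: r_def)
    also have "\<dots> \<le> 1 / 2"
      by (simp add: field_simps)
    finally show "\<bar>M\<bar> * r \<le> 1 / 2" .
  qed
  have halving: "\<forall>x\<in>ball x0 r. norm (f x) \<le> (1 / 2) ^ n" for n
  proof (induction n)
    case 0
    have "norm (f x) < 1" if "x \<in> ball x0 r" for x
      using in_ball[of x] r(2) that by (simp add: dist_commute)
    then show ?case
      by (auto intro: less_imp_le)
  next
    case (Suc n)
    show ?case
    proof
      fix x assume x: "x \<in> ball x0 r"
      have "norm (f x - f x0) \<le> (\<bar>M\<bar> * (1 / 2) ^ n) * norm (x - x0)"
      proof (rule field_differentiable_bound[where S = "ball x0 r" and f' = f'])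
        fix z assume z: "z \<in> ball x0 r"
        then have z': "dist z x0 < d"
          using r(2) by (simp add: dist_commute)
        show "(f has_field_derivative f' z) (at z within ball x0 r)"
          using in_ball[OF z'] by (blast intro: has_field_derivative_at_within)
        have "norm (f' z) \<le> M * norm (f z)"
          using in_ball[OF z'] by blast
        also have "\<dots> \<le> \<bar>M\<bar> * (1 / 2) ^ n"
          using Suc.IH z by (intro mult_mono) auto
        finally show "norm (f' z) \<le> \<bar>M\<bar> * (1 / 2) ^ n" .
      qed (use x r(1) in auto)
      also have "\<dots> \<le> (\<bar>M\<bar> * (1 / 2) ^ n) * r"
        using x by (intro mult_left_mono) (auto simp: dist_norm norm_minus_commute)
      also have "\<dots> = (\<bar>M\<bar> * r) * (1 / 2) ^ n"
        by simp
      also have "\<dots> \<le> 1 / 2 * (1 / 2) ^ n"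
        using r(3) by (intro mult_right_mono) auto
      finally show "norm (f x) \<le> (1 / 2) ^ Suc n"
        using zero by simp
    qed
  qed
  have "f x = 0" if "x \<in> ball x0 r" for x
  proof -
    have "(\<lambda>n. (1 / 2 :: real) ^ n) \<longlonglongrightarrow> 0"
      by (rule LIMSEQ_power_zero) simp
    then have "norm (f x) \<le> 0"
      by (rule LIMSEQ_le_const) (use halving that in blast)
    then show ?thesis
      by simp
  qed
  then show ?thesis
    using r(1) unfolding eventually_nhds_metric by (auto simp: dist_commute)
qed

lemma derivative_zero_if_locally_zero:
  fixes f :: "'a::real_normed_field \<Rightarrow> 'a"
  assumes "(f has_field_derivative c) (at x)" "eventually (\<lambda>y. f y = 0) (nhds x)"
  shows "c = 0"
proof -
  have "((\<lambda>_. 0) has_field_derivative c) (at x)"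
    using assms DERIV_cong_ev[OF refl assms(2) refl] by blast
  then show ?thesis
    using DERIV_unique DERIV_const by blast
qed

section \<open>Multiple roots of the quartic\<close>

text \<open>
  Eliminating \<open>R\<close> between the quartic and its derivative leaves
  \<open>-3 (\<mu>\<^sup>2 + Q / 72)\<^sup>2 = 0\<close>.
\<close>

lemma multiple_root_values:
  fixes m q r :: "'a::field_char_0"
  assumes root: "m^4 + 1 / 12 * q * m^2 + 1 / 27 * r * m - 1 / 1728 * q^2 = 0"
    and derivative: "4 * m^3 + 1 / 6 * q * m + 1 / 27 * r = 0"
  shows "q = - 72 * m^2" "r = 216 * m^3"
proof -
  have r: "r = - 108 * m^3 - 9 / 2 * q * m"
    using derivative by (simp add: field_simps) algebra
  have "(q + 72 * m^2)^2 = 0"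
    using root unfolding r by (simp add: field_simps) algebra
  then show q: "q = - 72 * m^2"
    by (simp add: add_eq_0_iff)
  show "r = 216 * m^3"
    unfolding r q by (simp add: power2_eq_square power3_eq_cube)
qed

text \<open>
  On the locus \<open>Q\<^sup>3 + 8 R\<^sup>2 = 0\<close> the roots of the quartic, multiplied by \<open>Q\<close>, are \<open>- R / 3\<close>
  three times and \<open>R\<close> once.
\<close>

lemma quartic_factors_on_discriminant_locus:
  fixes m q r :: "'a::field_char_0"
  assumes root: "m^4 + 1 / 12 * q * m^2 + 1 / 27 * r * m - 1 / 1728 * q^2 = 0"
    and disc: "q^3 + 8 * r^2 = 0"
  shows "(q * m + r / 3) * (q * m - r) = 0"
proof -
  have "1728 * m^4 + 144 * q * m^2 + 64 * r * m - q^2 = 0"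
    using root by (simp add: field_simps) algebra
  with disc have "(3 * (q * m) + r)^3 * (q * m - r) = 0"
    by algebra
  then have "3 * (q * m) + r = 0 \<or> q * m - r = 0"
    by simp
  moreover have "q * m + r / 3 = (3 * (q * m) + r) / 3"
    by (simp add: field_simps)
  ultimately show ?thesis
    by (metis divide_eq_0_iff mult_eq_0_iff)
qed

section \<open>The derivative of a root along a solution\<close>

text \<open>
  The quartic is assumed on all of \<open>S\<close>, not just at \<open>x\<close>, and at a multiple root this matters: the
  quartic and its first derivative at \<open>x\<close> alone leave \<open>\<mu>'\<close> undetermined, and the value is read off
  from the form of the solution in a neighbourhood.
\<close>

lemma chazy_root_derivative:
  fixes S :: "'a::real_normed_field set"
  assumes "open S" and sys: "chazy_system 2 S P Q R"
    and root: "\<And>x. x \<in> S \<Longrightarrow>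
      (\<mu> x)^4 + 1 / 12 * Q x * (\<mu> x)^2 + 1 / 27 * R x * \<mu> x - 1 / 1728 * (Q x)^2 = 0"
    and x: "x \<in> S" and der: "(\<mu> has_field_derivative c) (at x)"
  shows "c = P x * \<mu> x / 3 - (\<mu> x)\<^sup>2 / 2 - Q x / 48"
proof -
  have dP: "(P has_field_derivative 1 / 6 * ((P y)\<^sup>2 - Q y)) (at y)"
    and dQ: "(Q has_field_derivative 2 / 3 * (P y * Q y - R y)) (at y)"
    and dR: "(R has_field_derivative P y * R y + 1 / 8 * (Q y)\<^sup>2) (at y)" if "y \<in> S" for y
    using sys that by (auto simp: chazy_system_def)
  have inS: "eventually (\<lambda>y. y \<in> S) (nhds x)"
    using \<open>open S\<close> x by (simp add: eventually_nhds_in_open)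
  let ?slope = "4 * (\<mu> x)^3 + 1 / 6 * Q x * \<mu> x + 1 / 27 * R x"
  have "((\<lambda>y. (\<mu> y)^4 + 1 / 12 * Q y * (\<mu> y)^2 + 1 / 27 * R y * \<mu> y - 1 / 1728 * (Q y)^2)
      has_field_derivative
        ?slope * c + ((\<mu> x)^2 / 12 - Q x / 864) * (2 / 3 * (P x * Q x - R x))
        + \<mu> x / 27 * (P x * R x + 1 / 8 * (Q x)\<^sup>2)) (at x)"
    by (rule derivative_eq_intros dQ dR der x refl)+ (simp add: field_simps)
  moreover have "eventually (\<lambda>y. (\<mu> y)^4 + 1 / 12 * Q y * (\<mu> y)^2 + 1 / 27 * R y * \<mu> y
      - 1 / 1728 * (Q y)^2 = 0) (nhds x)"
    using inS by eventually_elim (rule root)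
  ultimately have slope_c: "?slope * c + ((\<mu> x)^2 / 12 - Q x / 864) * (2 / 3 * (P x * Q x - R x))
        + \<mu> x / 27 * (P x * R x + 1 / 8 * (Q x)\<^sup>2) = 0"
    by (rule derivative_zero_if_locally_zero)
  show ?thesis
  proof (cases "?slope = 0")
    case False
    \<comment> \<open>The candidate satisfies the differentiated quartic up to a multiple of the quartic itself:
      the terms in \<open>P\<close> combine by homogeneity (\<open>\<mu>\<close>, \<open>Q\<close>, \<open>R\<close> having weights 1, 2, 3), the others
      are \<open>-2 \<mu>\<close> times the quartic.\<close>
    have "?slope * (P x * \<mu> x / 3 - (\<mu> x)\<^sup>2 / 2 - Q x / 48)
        + ((\<mu> x)^2 / 12 - Q x / 864) * (2 / 3 * (P x * Q x - R x))
        + \<mu> x / 27 * (P x * R x + 1 / 8 * (Q x)\<^sup>2)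
      = (4 / 3 * P x - 2 * \<mu> x) *
        ((\<mu> x)^4 + 1 / 12 * Q x * (\<mu> x)^2 + 1 / 27 * R x * \<mu> x - 1 / 1728 * (Q x)^2)"
      by (simp add: field_simps eval_nat_numeral)
    also have "\<dots> = 0"
      by (simp only: root[OF x] mult_zero_right)
    also note slope_c[symmetric]
    finally have "?slope * c = ?slope * (P x * \<mu> x / 3 - (\<mu> x)\<^sup>2 / 2 - Q x / 48)"
      by (simp only: add_right_cancel)
    with False show ?thesis
      by (metis mult_left_cancel)
  next
    case True
    note vals = multiple_root_values[OF root[OF x] True]
    define D where "D = (\<lambda>y. (Q y)^3 + 8 * (R y)^2)"
    have dD: "(D has_field_derivative 2 * P y * D y) (at y)" if "y \<in> S" for y
      unfolding D_def using that
      by (auto intro!: derivative_eq_intros dQ dR simp: field_simps eval_nat_numeral)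
    have "isCont P x"
      using DERIV_isCont[OF dP[OF x]] .
    then have "((\<lambda>y. norm (P y)) \<longlongrightarrow> norm (P x)) (nhds x)"
      by (intro tendsto_norm) (simp add: continuous_at tendsto_nhds_iff)
    then have Pbound: "eventually (\<lambda>y. norm (P y) < norm (P x) + 1) (nhds x)"
      by (rule order_tendstoD) simp
    have "D x = 0"
      unfolding D_def vals by (simp add: power_mult_distrib flip: power_mult)
    have D0: "eventually (\<lambda>y. D y = 0) (nhds x)"
    proof (rule locally_zero_if_derivative_bounded)
      show "eventually (\<lambda>y. (D has_field_derivative 2 * P y * D y) (at y) \<and>
          norm (2 * P y * D y) \<le> 2 * (norm (P x) + 1) * norm (D y)) (nhds x)"
        using inS Pbound
        by eventually_elim (auto simp: dD norm_mult intro!: mult_right_mono)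
    qed fact
    show ?thesis
    proof (cases "\<mu> x = 0")
      case True
      with vals have zero: "Q x = 0" "R x = 0"
        by simp_all
      have "isCont Q x"
        using DERIV_isCont[OF dQ[OF x]] .
      then have "((\<lambda>y. norm (Q y)) \<longlongrightarrow> norm (Q x)) (nhds x)"
        by (intro tendsto_norm) (simp add: continuous_at tendsto_nhds_iff)
      then have Qbound: "eventually (\<lambda>y. norm (Q y) < 1) (nhds x)"
        by (rule order_tendstoD) (simp add: zero)
      \<comment> \<open>Since \<open>8 R\<^sup>2 = - Q\<^sup>3\<close> and \<open>Q\<close> is small nearby, the size of \<open>R\<close> is controlled by that
        of \<open>Q\<close>, so the equation for \<open>Q\<close> alone already gives a linear bound.\<close>
      have Q0: "eventually (\<lambda>y. Q y = 0) (nhds x)"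
      proof (rule locally_zero_if_derivative_bounded)
        show "eventually (\<lambda>y. (Q has_field_derivative 2 / 3 * (P y * Q y - R y)) (at y) \<and>
            norm (2 / 3 * (P y * Q y - R y)) \<le> (norm (P x) + 2) * norm (Q y)) (nhds x)"
          using inS Pbound Qbound D0
        proof eventually_elim
          case (elim y)
          have "8 * (R y)^2 = - ((Q y)^3)"
            using elim(4) by (simp add: D_def add_eq_0_iff)
          then have "norm (8 * (R y)^2) = norm ((Q y)^3)"
            by simp
          then have "8 * norm (R y)^2 = norm (Q y)^3"
            by (simp add: norm_mult norm_power)
          also have "\<dots> \<le> norm (Q y)^2"
            using elim(3) by (intro power_decreasing) auto
          finally have "norm (R y)^2 \<le> norm (Q y)^2"
            using zero_le_power2[of "norm (R y)"] by linarith
          then have RQ: "norm (R y) \<le> norm (Q y)"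
            by (simp add: power_mono_iff)
          have "norm (2 / 3 * (P y * Q y - R y)) \<le> 1 * norm (P y * Q y - R y)"
            unfolding norm_mult by (intro mult_right_mono) (auto simp: norm_divide)
          also have "\<dots> \<le> norm (P y) * norm (Q y) + norm (R y)"
            using norm_triangle_ineq4[of "P y * Q y" "R y"] by (simp add: norm_mult)
          also have "\<dots> \<le> (norm (P x) + 1) * norm (Q y) + norm (Q y)"
            using elim(2) RQ by (intro add_mono mult_right_mono) auto
          finally show ?case
            using dQ[OF elim(1)] by (simp add: algebra_simps)
        qed
      qed fact
      have "eventually (\<lambda>y. \<mu> y = 0) (nhds x)"
        using inS Q0 D0
      proof eventually_elim
        case (elim y)
        then show ?case
          using root[of y] by (simp add: D_def)
      qed
      with der have "c = 0"
        by (rule derivative_zero_if_locally_zero)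
      then show ?thesis
        by (simp add: True zero)
    next
      case False
      \<comment> \<open>At \<open>x\<close> the factor \<open>Q \<mu> + R / 3\<close> of the quartic vanishes and the other one does not; the
        vanishing of the derivative of their product therefore says \<open>(Q \<mu> + R / 3)' = 0\<close>.\<close>
      let ?h' = "2 / 3 * (P x * Q x - R x) * \<mu> x + Q x * c + (P x * R x + 1 / 8 * (Q x)\<^sup>2) / 3"
      let ?k' = "2 / 3 * (P x * Q x - R x) * \<mu> x + Q x * c - (P x * R x + 1 / 8 * (Q x)\<^sup>2)"
      have "((\<lambda>y. (Q y * \<mu> y + R y / 3) * (Q y * \<mu> y - R y)) has_field_derivative
          ?h' * (Q x * \<mu> x - R x) + (Q x * \<mu> x + R x / 3) * ?k') (at x)"
        by (rule derivative_eq_intros dQ dR der x refl | (simp; fail))+ (simp add: field_simps)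
      moreover have "eventually (\<lambda>y. (Q y * \<mu> y + R y / 3) * (Q y * \<mu> y - R y) = 0) (nhds x)"
        using inS D0
        by eventually_elim (rule quartic_factors_on_discriminant_locus[OF root], auto simp: D_def)
      ultimately have "?h' * (Q x * \<mu> x - R x) + (Q x * \<mu> x + R x / 3) * ?k' = 0"
        by (rule derivative_zero_if_locally_zero)
      moreover have "Q x * \<mu> x + R x / 3 = 0" "Q x * \<mu> x - R x = - 288 * (\<mu> x)^3"
        by (simp_all add: vals power2_eq_square power3_eq_cube)
      ultimately have "?h' = 0"
        using False by simp
      then have "(\<mu> x)^2 * c = (\<mu> x)^2 * (P x * \<mu> x / 3 - (\<mu> x)\<^sup>2 / 2 - Q x / 48)"
        unfolding vals by (simp add: field_simps) algebra
      with False show ?thesis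
        by simp
    qed
  qed
qed

section \<open>The two transformations\<close>

lemma chazy_2_to_2_3:
  fixes S :: "'a::real_normed_field set"
  assumes "open S" and sys: "chazy_system 2 S P Q R"
    and diff: "\<And>x. x \<in> S \<Longrightarrow> \<mu> field_differentiable (at x)"
    and root: "\<And>x. x \<in> S \<Longrightarrow>
      (\<mu> x)^4 + 1 / 12 * Q x * (\<mu> x)^2 + 1 / 27 * R x * \<mu> x - 1 / 1728 * (Q x)^2 = 0"
  shows "chazy_system (2 / 3) S
              (\<lambda>x. P x + 2 * \<mu> x)
              (\<lambda>x. 5 / 4 * Q x + 10 * (\<mu> x)^2)
              (\<lambda>x. 5 / 4 * R x + 25 / 8 * Q x * \<mu> x + 35 * (\<mu> x)^3)"
  unfolding chazy_system_def
proof (intro ballI conjI)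
  fix x assume x: "x \<in> S"
  have dP: "(P has_field_derivative 1 / 6 * ((P x)\<^sup>2 - Q x)) (at x)"
    and dQ: "(Q has_field_derivative 2 / 3 * (P x * Q x - R x)) (at x)"
    and dR: "(R has_field_derivative P x * R x + 1 / 8 * (Q x)\<^sup>2) (at x)"
    using sys x by (auto simp: chazy_system_def)
  have dm: "(\<mu> has_field_derivative P x * \<mu> x / 3 - (\<mu> x)\<^sup>2 / 2 - Q x / 48) (at x)"
    using diff[OF x] chazy_root_derivative[OF \<open>open S\<close> sys root x]
    unfolding field_differentiable_def by blast
  show "((\<lambda>x. P x + 2 * \<mu> x) has_field_derivative
      1 / 6 * ((P x + 2 * \<mu> x)\<^sup>2 - (5 / 4 * Q x + 10 * (\<mu> x)\<^sup>2))) (at x)"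
    by (rule derivative_eq_intros dP dm refl)+ (simp add: field_simps power2_eq_square)
  show "((\<lambda>x. 5 / 4 * Q x + 10 * (\<mu> x)\<^sup>2) has_field_derivative
      2 / 3 * ((P x + 2 * \<mu> x) * (5 / 4 * Q x + 10 * (\<mu> x)\<^sup>2)
        - (5 / 4 * R x + 25 / 8 * Q x * \<mu> x + 35 * (\<mu> x)^3))) (at x)"
    by (rule derivative_eq_intros dQ dm refl)+ (simp add: field_simps eval_nat_numeral)
  \<comment> \<open>The first two equations are identities once \<open>\<mu>'\<close> is inserted; the third holds only modulo the
    quartic.\<close>
  have Q2: "(Q x)\<^sup>2 = 1728 * (\<mu> x)^4 + 144 * Q x * (\<mu> x)^2 + 64 * R x * \<mu> x"
    using root[OF x] by (simp add: field_simps) algebra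
  show "((\<lambda>x. 5 / 4 * R x + 25 / 8 * Q x * \<mu> x + 35 * (\<mu> x)^3) has_field_derivative
      (P x + 2 * \<mu> x) * (5 / 4 * R x + 25 / 8 * Q x * \<mu> x + 35 * (\<mu> x)^3)
        + (2 / 3)\<^sup>2 / (36 - (2 / 3)\<^sup>2) * (5 / 4 * Q x + 10 * (\<mu> x)\<^sup>2)\<^sup>2) (at x)"
    using Q2 by - ((rule derivative_eq_intros dR dQ dm refl)+, simp add: field_simps, algebra)
qed

lemma chazy_2_3_to_2:
  fixes S :: "'a::real_normed_field set"
  assumes sys: "chazy_system (2 / 3) S P Q R"
  shows "chazy_system 2 {x \<in> S. R x \<noteq> 0}
              (\<lambda>x. P x - (Q x)^2 / (40 * R x))
              (\<lambda>x. 4 / 5 * Q x - (Q x)^4 / (800 * (R x)^2))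
              (\<lambda>x. 4 / 5 * R x - (Q x)^3 / (40 * R x) - (Q x)^6 / (64000 * (R x)^3))"
  unfolding chazy_system_def
proof (intro ballI conjI)
  fix x assume "x \<in> {x \<in> S. R x \<noteq> 0}"
  then have x: "x \<in> S" and nz: "R x \<noteq> 0"
    by auto
  have dP: "(P has_field_derivative 1 / 6 * ((P x)\<^sup>2 - Q x)) (at x)"
    and dQ: "(Q has_field_derivative 2 / 3 * (P x * Q x - R x)) (at x)"
    and dR: "(R has_field_derivative P x * R x + 1 / 80 * (Q x)\<^sup>2) (at x)"
    using sys x by (auto simp: chazy_system_def power_divide)
  show "((\<lambda>x. P x - (Q x)^2 / (40 * R x)) has_field_derivative
      1 / 6 * ((P x - (Q x)^2 / (40 * R x))\<^sup>2 - (4 / 5 * Q x - (Q x)^4 / (800 * (R x)^2)))) (at x)"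
    using nz
    by - ((rule derivative_eq_intros dP dQ dR refl | (simp; fail))+,
      simp add: field_simps eval_nat_numeral)
  show "((\<lambda>x. 4 / 5 * Q x - (Q x)^4 / (800 * (R x)^2)) has_field_derivative
      2 / 3 * ((P x - (Q x)^2 / (40 * R x)) * (4 / 5 * Q x - (Q x)^4 / (800 * (R x)^2))
        - (4 / 5 * R x - (Q x)^3 / (40 * R x) - (Q x)^6 / (64000 * (R x)^3)))) (at x)"
    using nz
    by - ((rule derivative_eq_intros dP dQ dR refl | (simp; fail))+,
      simp add: field_simps eval_nat_numeral)
  show "((\<lambda>x. 4 / 5 * R x - (Q x)^3 / (40 * R x) - (Q x)^6 / (64000 * (R x)^3)) has_field_derivative
      (P x - (Q x)^2 / (40 * R x)) * (4 / 5 * R x - (Q x)^3 / (40 * R x) - (Q x)^6 / (64000 * (R x)^3))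
      + 2\<^sup>2 / (36 - 2\<^sup>2) * (4 / 5 * Q x - (Q x)^4 / (800 * (R x)^2))\<^sup>2) (at x)"
    using nz
    by - ((rule derivative_eq_intros dP dQ dR refl | (simp; fail))+,
      simp add: field_simps eval_nat_numeral)
qed

theorem theorem3p2:
  fixes S :: "'a::real_normed_field set"
  assumes "open S"
  shows
    "(\<forall>P Q R \<mu>.
        chazy_system 2 S P Q R \<and>
        (\<forall>x\<in>S. \<mu> field_differentiable (at x)) \<and>
        (\<forall>x\<in>S. (\<mu> x)^4 + 1 / 12 * Q x * (\<mu> x)^2 + 1 / 27 * R x * \<mu> x - 1 / 1728 * (Q x)^2 = 0)
        \<longrightarrow> chazy_system (2 / 3) S
              (\<lambda>x. P x + 2 * \<mu> x)
              (\<lambda>x. 5 / 4 * Q x + 10 * (\<mu> x)^2)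
              (\<lambda>x. 5 / 4 * R x + 25 / 8 * Q x * \<mu> x + 35 * (\<mu> x)^3))
     \<and>
     (\<forall>P Q R.
        chazy_system (2 / 3) S P Q R
        \<longrightarrow> chazy_system 2 {x \<in> S. R x \<noteq> 0}
              (\<lambda>x. P x - (Q x)^2 / (40 * R x))
              (\<lambda>x. 4 / 5 * Q x - (Q x)^4 / (800 * (R x)^2))
              (\<lambda>x. 4 / 5 * R x - (Q x)^3 / (40 * R x) - (Q x)^6 / (64000 * (R x)^3)))"
  using chazy_2_to_2_3[OF assms] chazy_2_3_to_2 by blast

end
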